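(* An $s$-stage SSEI method (special symplectic exponential integrator) $\varphi_h$ is volume preserving if and only if, for all $y$, $$\bigl|I_s\otimes I-h\,(A\otimes I\,.\!*\,E(hK))\,F\bigr|=|e^{hK}|\;\bigl|I_s\otimes I+h\,(A^{\intercal}\otimes I\,.\!*\,E(hK))\,F\bigr| ,$$ where $E(hK)=(E_{i,j}(hK))_{s\times s}$ is the block matrix with $n\times n$ blocks $E_{i,j}(hK)=e^{(c_i-c_j)hK}$ (so the diagonal blocks are $I$), $F=\mathrm{diag}(g'(k_1),\dots,g'(k_s))$ (block diagonal, $k_i=k_i(y)$ the stages), and, for an $s\times s$ matrix $M=(m_{ij})$, $M\otimes I\,.\!*\,E(hK)$ denotes the block matrix with blocks $m_{ij}e^{(c_i-c_j)hK}$.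
   Context: Consider the ODE $y'(t)=Ky(t)+g(y(t))=:f(y(t))$ on $\mathbb{R}^n$, where $K$ is a real $n\times n$ matrix with $|e^{hK}|\neq-1$ for $0<h<1$, $g:\mathbb{R}^n\to\mathbb{R}^n$ is differentiable, and $f$ is divergence free. $|\cdot|$ denotes the determinant; $I_s$ and $I$ are the $s\times s$ and $n\times n$ identity matrices. SSEI method: let $c=(c_1,\dots,c_s)^{\intercal}$, $b=(b_1,\dots,b_s)^{\intercal}$, $A=(a_{ij})_{s\times s}$ be the coefficients of an $s$-stage Runge--Kutta method which is symplectic, i.e. $b_ia_{ij}+b_ja_{ji}-b_ib_j=0$ for all $i,j$, and satisfies $b_j\neq0$ for all $j$. The corresponding $s$-stage SSEI method is the map $$\varphi_h(y)=e^{hK}y+h\sum_{i=1}^{s}b_ie^{(1-c_i)hK}g(k_i(y)),\qquad k_i(y)=e^{c_ihK}y+h\sum_{j=1}^{s}a_{ij}e^{(c_i-c_j)hK}g(k_j(y)),\quad i=1,\dots,s.$$ It is understood that the stage equations define $k_1,\dots,k_s$ as differentiable functions of $y$ and that the matrix $I_s\otimes I-h(a_{ij}e^{(c_i-c_j)hK})_{i,j}F$ is invertible. The method is volume preserving (for the given ODE) if $|\varphi_h'(y)|=1$ for all $y$. *)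

theory Defs
  imports "HOL-Analysis.Analysis"
begin

text \<open>The library's \<open>exp\<close>, \<open>*\<close> and \<open>^\<close> are of no use for matrices here: the ring structure
  on \<open>real ^ 'n ^ 'n\<close> is componentwise.\<close>

definition mexp :: "real ^ 'n ^ 'n \<Rightarrow> real ^ 'n ^ 'n" where
  "mexp X = (\<Sum>m. (1 / fact m) *\<^sub>R ((\<lambda>Y. X ** Y) ^^ m) (mat 1))"

lemma matrix_power_entry_bound:
  fixes X :: "real ^ 'n ^ 'n"
  shows "\<bar>((\<lambda>Y. X ** Y) ^^ m) (mat 1) $ i $ j\<bar> \<le> (real CARD('n) * norm X) ^ m"
proof (induction m arbitrary: i j)
  case 0
  then show ?case by (simp add: mat_def)
next
  case (Suc m)
  have entry: "\<bar>X $ i $ l\<bar> \<le> norm X" for l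
    using component_le_norm_cart[of "X $ i" l] Finite_Cartesian_Product.norm_nth_le[of X i] by linarith
  have "\<bar>((\<lambda>Y. X ** Y) ^^ Suc m) (mat 1) $ i $ j\<bar>
      \<le> (\<Sum>l\<in>UNIV. \<bar>X $ i $ l * ((\<lambda>Y. X ** Y) ^^ m) (mat 1) $ l $ j\<bar>)"
    by (simp add: matrix_matrix_mult_def sum_abs)
  also have "\<dots> \<le> (\<Sum>l\<in>(UNIV :: 'n set). norm X * (real CARD('n) * norm X) ^ m)"
    unfolding abs_mult by (intro sum_mono mult_mono Suc.IH entry) auto
  finally show ?case by (simp add: algebra_simps)
qed

lemma summable_mexp:
  fixes X :: "real ^ 'n ^ 'n"
  shows "summable (\<lambda>m. (1 / fact m) *\<^sub>R ((\<lambda>Y. X ** Y) ^^ m) (mat 1))"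
proof (rule summable_comparison_test')
  let ?c = "real CARD('n) * norm X" and ?N = "real CARD('n) * real CARD('n)"
  show "summable (\<lambda>m. ?N * (inverse (fact m) * ?c ^ m))"
    by (intro summable_mult summable_exp)
  fix m :: nat
  let ?P = "((\<lambda>Y. X ** Y) ^^ m) (mat 1)"
  have "norm ?P \<le> (\<Sum>i\<in>UNIV. norm (?P $ i))"
    by (simp add: norm_vec_def L2_set_le_sum)
  also have "\<dots> \<le> (\<Sum>i\<in>UNIV. \<Sum>j\<in>UNIV. \<bar>?P $ i $ j\<bar>)"
    by (intro sum_mono norm_le_l1_cart)
  also have "\<dots> \<le> (\<Sum>i\<in>(UNIV :: 'n set). \<Sum>j\<in>(UNIV :: 'n set). ?c ^ m)"
    by (intro sum_mono matrix_power_entry_bound)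
  finally have "norm ?P \<le> ?N * ?c ^ m" by simp
  then have "inverse (fact m) * norm ?P \<le> inverse (fact m) * (?N * ?c ^ m)"
    by (intro mult_left_mono) auto
  then show "norm ((1 / fact m) *\<^sub>R ?P) \<le> ?N * (inverse (fact m) * ?c ^ m)"
    by (simp add: field_simps)
qed

definition divergence_free :: "(real ^ 'n \<Rightarrow> real ^ 'n) \<Rightarrow> bool" where
  "divergence_free f \<longleftrightarrow>
     (\<forall>y. f differentiable at y \<and> (\<Sum>i\<in>UNIV. jacobian f (at y) $ i $ i) = 0)"

definition volume_preserving :: "(real ^ 'n \<Rightarrow> real ^ 'n) \<Rightarrow> bool" where
  "volume_preserving \<phi> \<longleftrightarrow>
     (\<forall>y. \<phi> differentiable at y \<and> det (jacobian \<phi> (at y)) = 1)"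

definition symplectic_RK :: "real ^ 's ^ 's \<Rightarrow> real ^ 's \<Rightarrow> bool" where
  "symplectic_RK A b \<longleftrightarrow>
     (\<forall>i j. b $ i * A $ i $ j + b $ j * A $ j $ i - b $ i * b $ j = 0)"

definition ssei_stages ::
  "real ^ 's ^ 's \<Rightarrow> real ^ 's \<Rightarrow> real ^ 'n ^ 'n \<Rightarrow> (real ^ 'n \<Rightarrow> real ^ 'n) \<Rightarrow> real
    \<Rightarrow> ('s \<Rightarrow> real ^ 'n \<Rightarrow> real ^ 'n) \<Rightarrow> bool" where
  "ssei_stages A c K g h k \<longleftrightarrow>
     (\<forall>i y. k i y = mexp ((c $ i * h) *\<^sub>R K) *v y
        + h *\<^sub>R (\<Sum>j\<in>UNIV. A $ i $ j *\<^sub>R (mexp (((c $ i - c $ j) * h) *\<^sub>R K) *v g (k j y))))"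

definition ssei_map ::
  "real ^ 's \<Rightarrow> real ^ 's \<Rightarrow> real ^ 'n ^ 'n \<Rightarrow> (real ^ 'n \<Rightarrow> real ^ 'n) \<Rightarrow> real
    \<Rightarrow> ('s \<Rightarrow> real ^ 'n \<Rightarrow> real ^ 'n) \<Rightarrow> real ^ 'n \<Rightarrow> real ^ 'n" where
  "ssei_map b c K g h k y = mexp (h *\<^sub>R K) *v y
     + h *\<^sub>R (\<Sum>i\<in>UNIV. b $ i *\<^sub>R (mexp (((1 - c $ i) * h) *\<^sub>R K) *v g (k i y)))"

text \<open>An \<open>s \<times> s\<close> array of \<open>n \<times> n\<close> blocks, flattened to a matrix indexed by
  (block index, index within the block).\<close>

definition block_matrix :: "('s::finite \<Rightarrow> 's \<Rightarrow> real ^ 'n ^ 'n) \<Rightarrow> real ^ ('s \<times> 'n) ^ ('s \<times> 'n)" where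
  "block_matrix B = (\<chi> p q. B (fst p) (fst q) $ snd p $ snd q)"

definition block_diag :: "('s::finite \<Rightarrow> real ^ 'n ^ 'n) \<Rightarrow> real ^ ('s \<times> 'n) ^ ('s \<times> 'n)" where
  "block_diag D = block_matrix (\<lambda>i j. if i = j then D i else 0)"

definition kron :: "real ^ 's ^ 's \<Rightarrow> real ^ 'n ^ 'n \<Rightarrow> real ^ ('s \<times> 'n) ^ ('s \<times> 'n)" where
  "kron M N = block_matrix (\<lambda>i j. M $ i $ j *\<^sub>R N)"

definition E_block :: "real ^ 's \<Rightarrow> real ^ 'n ^ 'n \<Rightarrow> 's \<Rightarrow> 's \<Rightarrow> real ^ 'n ^ 'n" where
  "E_block c X i j = mexp ((c $ i - c $ j) *\<^sub>R X)"

text \<open>\<open>M \<otimes> I .* E\<close>: every block \<open>E i j\<close> is scaled by the number \<open>M $ i $ j\<close>. This is not the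
  entrywise product of \<open>kron M (mat 1)\<close> with the flattened \<open>E\<close>, which would discard the
  off-diagonal entries of each block.\<close>

definition block_scale ::
  "real ^ 's ^ 's \<Rightarrow> ('s \<Rightarrow> 's \<Rightarrow> real ^ 'n ^ 'n) \<Rightarrow> real ^ ('s \<times> 'n) ^ ('s \<times> 'n)" where
  "block_scale M E = block_matrix (\<lambda>i j. M $ i $ j *\<^sub>R E i j)"

text \<open>\<open>F = diag (g' (k\<^sub>1 y), \<dots>, g' (k\<^sub>s y))\<close>.\<close>

definition stage_jacobians ::
  "(real ^ 'n \<Rightarrow> real ^ 'n) \<Rightarrow> ('s::finite \<Rightarrow> real ^ 'n \<Rightarrow> real ^ 'n) \<Rightarrow> real ^ 'n
    \<Rightarrow> real ^ ('s \<times> 'n) ^ ('s \<times> 'n)" where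
  "stage_jacobians g k y = block_diag (\<lambda>i. jacobian g (at (k i y)))"

end

theory Submission
  imports Defs
begin

text \<open>Write \<open>X = hK\<close>, \<open>G\<^sub>j = g'(k\<^sub>j)\<close>, \<open>J\<^sub>j = k\<^sub>j'\<close> and \<open>H\<^sub>i\<^sub>j = e\<^bsup>(c\<^sub>i - c\<^sub>j)X\<^esup> G\<^sub>j\<close>, so that the
  two determinants in the criterion are those of \<open>N = 1 - h (a\<^sub>i\<^sub>j H\<^sub>i\<^sub>j)\<close> and
  \<open>N' = 1 + h (a\<^sub>j\<^sub>i H\<^sub>i\<^sub>j)\<close>. The proof establishes, at every point \<open>y\<close>, the identity
  \<open>det N * det \<phi>' = det e\<^bsup>X\<^esup> * det N'\<close> (lemma \<open>det_jacobian_ssei_map\<close>). Since \<open>det N \<noteq> 0\<close>,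
  it shows that \<open>det \<phi>' = 1\<close> exactly when \<open>det N = det e\<^bsup>X\<^esup> * det N'\<close>.

  To obtain the identity, differentiate the stage equations: the column \<open>J\<close> of the stage
  Jacobians solves \<open>N J = Q\<close>, where \<open>Q\<close> is the column with blocks \<open>Q\<^sub>i = e\<^bsup>c\<^sub>i X\<^esup>\<close>. Differentiate
  the update and use \<open>e\<^bsup>(1 - c\<^sub>j)X\<^esup> = e\<^bsup>X\<^esup> e\<^bsup>-c\<^sub>j X\<^esup>\<close> to pull out the flow of the linear part:
  \<open>\<phi>' = e\<^bsup>X\<^esup> (1 + h R J)\<close>, where \<open>R\<close> is the row with blocks \<open>R\<^sub>j = b\<^sub>j e\<^bsup>-c\<^sub>j X\<^esup> G\<^sub>j\<close>. Sylvester's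
  determinant identity, in the form \<open>matrix_determinant_lemma\<close>, converts an \<open>n \<times> n\<close> determinant into
  an \<open>sn \<times> sn\<close> one: \<open>det N * det (1 + h R J) = det (N + h Q R)\<close>. The product \<open>Q R\<close> has blocks
  \<open>b\<^sub>j H\<^sub>i\<^sub>j\<close> by the addition law of the exponential, hence \<open>N + h Q R = 1 + h ((b\<^sub>j - a\<^sub>i\<^sub>j) H\<^sub>i\<^sub>j)\<close>.

  Symplecticity enters in this last form. It says \<open>b\<^sub>i (b\<^sub>j - a\<^sub>i\<^sub>j) = b\<^sub>j a\<^sub>j\<^sub>i\<close>, which means that the invertible
  block diagonal matrix with blocks \<open>b\<^sub>i I\<close> conjugates \<open>N + h Q R\<close> to \<open>N'\<close>; so both have
  the same determinant (lemma \<open>det_weighted_conjugation\<close>).\<close>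

section \<open>Matrix arithmetic\<close>

lemma matrix_add_rdistrib: "(M + N) ** P = M ** P + N ** P"
  by (simp add: matrix_matrix_mult_def vec_eq_iff distrib_right sum.distrib)

lemma matrix_diff_rdistrib:
  fixes M N :: "real ^ 'm ^ 'n"
  shows "(M - N) ** P = M ** P - N ** P"
  by (simp add: matrix_matrix_mult_def vec_eq_iff left_diff_distrib sum_subtractf)

lemma matrix_sum_ldistrib: "M ** (\<Sum>i\<in>S. N i) = (\<Sum>i\<in>S. M ** N i)"
  by (induction S rule: infinite_finite_induct) (simp_all add: matrix_add_ldistrib)

section \<open>Addition law of the matrix exponential\<close>

definition matrix_power :: "real ^ 'n ^ 'n \<Rightarrow> nat \<Rightarrow> real ^ 'n ^ 'n" where
  "matrix_power X m = ((\<lambda>Y. X ** Y) ^^ m) (mat 1)"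

lemma matrix_power_add: "matrix_power X (l + m) = matrix_power X l ** matrix_power X m"
  by (induction l) (simp_all add: matrix_power_def matrix_mul_assoc)

lemma matrix_power_scaleR: "matrix_power (r *\<^sub>R X) m = r ^ m *\<^sub>R matrix_power X m"
  by (induction m) (simp_all add: matrix_power_def matrix_scalar_ac scalar_matrix_assoc mult.commute)

lemma mexp_component:
  fixes X :: "real ^ 'n ^ 'n"
  shows "mexp X $ i $ j = (\<Sum>m. matrix_power X m $ i $ j / fact m)"
proof -
  have "bounded_linear (\<lambda>Y :: real ^ 'n ^ 'n. Y $ i $ j)"
    by (intro bounded_linear_compose[OF bounded_linear_vec_nth] bounded_linear_vec_nth)
  from bounded_linear.suminf[OF this summable_mexp[of X]]
  show ?thesis by (simp add: mexp_def matrix_power_def)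
qed

lemma summable_mexp_component:
  fixes X :: "real ^ 'n ^ 'n"
  shows "summable (\<lambda>m. norm (matrix_power X m $ i $ j / fact m))"
proof (rule summable_comparison_test')
  let ?c = "real CARD('n) * norm X"
  show "summable (\<lambda>m. inverse (fact m) * ?c ^ m)" by (rule summable_exp)
  show "norm (norm (matrix_power X m $ i $ j / fact m)) \<le> inverse (fact m) * ?c ^ m" for m
    using matrix_power_entry_bound[where X = X and m = m and i = i and j = j]
    by (simp add: matrix_power_def field_simps)
qed

text \<open>The product of the matrix type as a normed algebra is componentwise and not \<open>**\<close>, so the
  Cauchy product of the two exponential series is taken entrywise: each entry of
  \<open>mexp (s *\<^sub>R X) ** mexp (t *\<^sub>R X)\<close> is a finite sum of products of absolutely convergent
  real series. The binomial theorem applies to the resulting coefficients because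
  \<open>s *\<^sub>R X\<close> and \<open>t *\<^sub>R X\<close> are multiples of the same matrix.\<close>

lemma mexp_add:
  "mexp ((s + t) *\<^sub>R X) = mexp (s *\<^sub>R X) ** mexp (t *\<^sub>R X)"
proof -
  let ?e = "\<lambda>r m i j. matrix_power (r *\<^sub>R X) m $ i $ j / fact m"
  have conv: "(\<Sum>l\<in>UNIV. \<Sum>q\<le>m. ?e s q i l * ?e t (m - q) l j) = ?e (s + t) m i j" for m i j
  proof -
    have "(\<Sum>l\<in>UNIV. \<Sum>q\<le>m. ?e s q i l * ?e t (m - q) l j)
        = (\<Sum>q\<le>m. s ^ q * t ^ (m - q) / (fact q * fact (m - q))
              * (\<Sum>l\<in>UNIV. matrix_power X q $ i $ l * matrix_power X (m - q) $ l $ j))"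
      by (subst sum.swap) (simp add: matrix_power_scaleR sum_distrib_left field_simps)
    also have "\<dots> = (\<Sum>q\<le>m. s ^ q * t ^ (m - q) / (fact q * fact (m - q)) * matrix_power X m $ i $ j)"
    proof (rule sum.cong[OF refl])
      fix q assume "q \<in> {..m}"
      then have "matrix_power X m = matrix_power X q ** matrix_power X (m - q)" by (simp add: matrix_power_add[symmetric])
      then show "s ^ q * t ^ (m - q) / (fact q * fact (m - q))
              * (\<Sum>l\<in>UNIV. matrix_power X q $ i $ l * matrix_power X (m - q) $ l $ j)
            = s ^ q * t ^ (m - q) / (fact q * fact (m - q)) * matrix_power X m $ i $ j"
        by (simp add: matrix_matrix_mult_def)
    qed
    also have "\<dots> = (s + t) ^ m / fact m * matrix_power X m $ i $ j"
      by (simp add: binomial_ring binomial_fact sum_divide_distrib sum_distrib_right)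
    finally show ?thesis by (simp add: matrix_power_scaleR)
  qed
  have "(mexp (s *\<^sub>R X) ** mexp (t *\<^sub>R X)) $ i $ j = mexp ((s + t) *\<^sub>R X) $ i $ j" for i j
  proof -
    have "(\<lambda>m. \<Sum>l\<in>UNIV. \<Sum>q\<le>m. ?e s q i l * ?e t (m - q) l j)
        sums (\<Sum>l\<in>UNIV. (\<Sum>m. ?e s m i l) * (\<Sum>m. ?e t m l j))"
      by (intro sums_sum Cauchy_product_sums summable_mexp_component)
    then have "(\<lambda>m. ?e (s + t) m i j) sums (mexp (s *\<^sub>R X) ** mexp (t *\<^sub>R X)) $ i $ j"
      by (simp only: conv matrix_matrix_mult_def vec_lambda_beta mexp_component)
    then show ?thesis by (simp add: mexp_component sums_iff)
  qed
  then show ?thesis by (simp add: vec_eq_iff)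
qed

section \<open>Sylvester's determinant identity\<close>

text \<open>The matrix \<open>M\<close> is transported along \<open>f\<close> to the indices in \<open>range f\<close> and completed by the
  identity. With \<open>f\<close> one of the injections of a sum type this is \<open>diag (M, I)\<close> or \<open>diag (I, M)\<close>;
  one definition handles both corners.\<close>

definition extend_by_identity :: "('a \<Rightarrow> 'b) \<Rightarrow> real ^ 'a ^ 'a \<Rightarrow> real ^ 'b ^ 'b" where
  "extend_by_identity f M = (\<chi> p q. if p \<in> range f \<and> q \<in> range f
     then M $ inv f p $ inv f q else of_bool (p = q))"

lemma extend_by_identity_inside:
  "inj f \<Longrightarrow> extend_by_identity f M $ f i $ f j = M $ i $ j"
  by (simp add: extend_by_identity_def)

lemma extend_by_identity_outside:
  "p \<notin> range f \<or> q \<notin> range f \<Longrightarrow> extend_by_identity f M $ p $ q = of_bool (p = q)"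
  by (auto simp: extend_by_identity_def)

lemma extend_by_identity_unique:
  assumes f: "inj f"
    and "\<And>i j. N $ f i $ f j = M $ i $ j"
    and "\<And>p q. p \<notin> range f \<or> q \<notin> range f \<Longrightarrow> N $ p $ q = of_bool (p = q)"
  shows "extend_by_identity f M = N"
proof -
  have "extend_by_identity f M $ p $ q = N $ p $ q" for p q
  proof (cases "p \<in> range f \<and> q \<in> range f")
    case True
    then show ?thesis using assms(2) extend_by_identity_inside[OF f] by auto
  next
    case False
    then show ?thesis using assms(3) extend_by_identity_outside by metis
  qed
  then show ?thesis by (simp add: vec_eq_iff)
qed

lemma extend_by_identity_mult:
  fixes f :: "'a::finite \<Rightarrow> 'b::finite"
  assumes f: "inj f"
  shows "extend_by_identity f (M ** N) = extend_by_identity f M ** extend_by_identity f N"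
    (is "_ = ?M ** ?N")
proof (rule extend_by_identity_unique[OF f])
  fix i j
  have "(?M ** ?N) $ f i $ f j = (\<Sum>r\<in>range f. ?M $ f i $ r * ?N $ r $ f j)"
    unfolding matrix_matrix_mult_def vec_lambda_beta
    by (rule sum.mono_neutral_right) (auto simp: extend_by_identity_outside)
  also have "\<dots> = (M ** N) $ i $ j"
    by (simp add: sum.reindex[OF f] extend_by_identity_inside[OF f] matrix_matrix_mult_def)
  finally show "(?M ** ?N) $ f i $ f j = (M ** N) $ i $ j" .
next
  fix p q assume "p \<notin> range f \<or> q \<notin> range f"
  then show "(?M ** ?N) $ p $ q = of_bool (p = q)"
  proof
    assume "p \<notin> range f"
    then show ?thesis
      by (simp add: matrix_matrix_mult_def extend_by_identity_outside)
  next
    assume "q \<notin> range f"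
    then show ?thesis
      by (simp add: matrix_matrix_mult_def extend_by_identity_outside)
  qed
qed

lemma det_column_swap:
  assumes "m \<noteq> n"
  shows "det (\<chi> i j. (mat 1 :: real ^ 'c ^ 'c) $ i $ Transposition.transpose m n j) = - 1"
  using assms det_permute_columns[of "Transposition.transpose m n" "mat 1 :: real ^ 'c ^ 'c"]
  by (simp add: permutes_swap_id sign_swap_id)

lemma det_transvection:
  assumes "m \<noteq> n"
  shows "det (\<chi> i j. of_bool (i = m \<and> j = n \<or> i = j) :: real ^ 'c ^ 'c) = 1"
proof -
  have "(\<chi> i j. of_bool (i = m \<and> j = n \<or> i = j) :: real ^ 'c ^ 'c)
      = (\<chi> k. if k = m then row m (mat 1) + 1 *s row n (mat 1) else row k (mat 1))"
    using assms by (auto simp: vec_eq_iff row_def mat_def)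
  then show ?thesis using det_row_operation[OF assms, of "mat 1" 1] by simp
qed

text \<open>The map \<open>extend_by_identity f\<close> is multiplicative and takes each elementary matrix to
  an elementary matrix of the same kind, so it suffices to compare determinants on the
  generators: matrices with a zero row, diagonal matrices, column swaps and transvections.\<close>

lemma det_extend_by_identity:
  fixes f :: "'a::finite \<Rightarrow> 'b::finite"
  assumes f: "inj f"
  shows "det (extend_by_identity f M) = det M"
proof (induction M rule: induct_matrix_elementary_alt)
  case (1 M N)
  then show ?case by (simp add: extend_by_identity_mult[OF f] det_mul)
next
  case (2 M i)
  have "row (f i) (extend_by_identity f M) $ q = 0" for q
  proof (cases "q \<in> range f")
    case True
    then obtain j where "q = f j" by auto
    with 2 show ?thesis
      by (simp add: row_def extend_by_identity_inside[OF f] vec_eq_iff)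
  next
    case False
    then have "f i \<noteq> q" by auto
    with False show ?thesis by (simp add: row_def extend_by_identity_outside)
  qed
  then have "row (f i) (extend_by_identity f M) = 0" by (simp add: vec_eq_iff)
  with 2 show ?case by (simp add: det_zero_row(2))
next
  case (3 M)
  have "extend_by_identity f M $ p $ q = 0" if "p \<noteq> q" for p q
  proof (cases "p \<in> range f \<and> q \<in> range f")
    case True
    then obtain i j where "p = f i" "q = f j" by auto
    with that 3[of i j] show ?thesis by (auto simp: extend_by_identity_inside[OF f])
  next
    case False
    with that show ?thesis by (simp add: extend_by_identity_outside)
  qed
  then have "det (extend_by_identity f M) = (\<Prod>p\<in>UNIV. extend_by_identity f M $ p $ p)"
    by (rule det_diagonal)
  also have "\<dots> = (\<Prod>p\<in>range f. extend_by_identity f M $ p $ p)"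
    by (rule prod.mono_neutral_right) (auto simp: extend_by_identity_outside)
  also have "\<dots> = (\<Prod>i\<in>UNIV. M $ i $ i)"
    by (simp add: prod.reindex[OF f] extend_by_identity_inside[OF f])
  also have "\<dots> = det M" using 3 by (rule det_diagonal[symmetric])
  finally show ?case .
next
  case (4 m n)
  have "extend_by_identity f (\<chi> i j. mat 1 $ i $ Transposition.transpose m n j)
      = (\<chi> i j. mat 1 $ i $ Transposition.transpose (f m) (f n) j)"
    by (rule extend_by_identity_unique[OF f])
      (auto simp: mat_def Transposition.transpose_def inj_eq[OF f])
  moreover have "f m \<noteq> f n" using 4 by (simp add: inj_eq[OF f])
  ultimately show ?case using 4 by (simp add: det_column_swap)
next
  case (5 m n)
  have "extend_by_identity f (\<chi> i j. of_bool (i = m \<and> j = n \<or> i = j))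
      = (\<chi> i j. of_bool (i = f m \<and> j = f n \<or> i = j))"
    by (rule extend_by_identity_unique[OF f]) (auto simp: inj_eq[OF f])
  moreover have "f m \<noteq> f n" using 5 by (simp add: inj_eq[OF f])
  ultimately show ?case
    using det_transvection[OF \<open>m \<noteq> n\<close>] det_transvection[OF \<open>f m \<noteq> f n\<close>] by simp
qed

definition four_blocks ::
  "real ^ 'a ^ 'a \<Rightarrow> real ^ 'b ^ 'a \<Rightarrow> real ^ 'a ^ 'b \<Rightarrow> real ^ 'b ^ 'b \<Rightarrow> real ^ ('a + 'b) ^ ('a + 'b)"
  where
  "four_blocks P Q R S = (\<chi> i j. case i of
       Inl a \<Rightarrow> (case j of Inl a' \<Rightarrow> P $ a $ a' | Inr b' \<Rightarrow> Q $ a $ b')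
     | Inr b \<Rightarrow> (case j of Inl a' \<Rightarrow> R $ b $ a' | Inr b' \<Rightarrow> S $ b $ b'))"

lemma sum_sum_index:
  "(\<Sum>r\<in>(UNIV :: ('a::finite + 'b::finite) set). u r) = (\<Sum>i\<in>UNIV. u (Inl i)) + (\<Sum>j\<in>UNIV. u (Inr j))"
  by (subst UNIV_Plus_UNIV[symmetric], subst sum.Plus) simp_all

lemma four_blocks_mult:
  "four_blocks P Q R S ** four_blocks P' Q' R' S'
    = four_blocks (P ** P' + Q ** R') (P ** Q' + Q ** S') (R ** P' + S ** R') (R ** Q' + S ** S')"
  by (simp add: four_blocks_def matrix_matrix_mult_def vec_eq_iff sum_sum_index split: sum.split)

lemma det_four_blocks_upper_left:
  "det (four_blocks P 0 0 (mat 1 :: real ^ 'b ^ 'b)) = det P"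
proof -
  have "four_blocks P 0 0 (mat 1 :: real ^ 'b ^ 'b) = extend_by_identity Inl P"
    by (auto simp: four_blocks_def extend_by_identity_def vec_eq_iff mat_def split: sum.split)
  then show ?thesis by (simp add: det_extend_by_identity)
qed

lemma det_four_blocks_lower_right:
  "det (four_blocks (mat 1 :: real ^ 'a ^ 'a) 0 0 S) = det S"
proof -
  have "four_blocks (mat 1 :: real ^ 'a ^ 'a) 0 0 S = extend_by_identity Inr S"
    by (auto simp: four_blocks_def extend_by_identity_def vec_eq_iff mat_def split: sum.split)
  then show ?thesis by (simp add: det_extend_by_identity)
qed

text \<open>Block elimination in the matrix with blocks \<open>I\<close>, \<open>-U\<close>, \<open>V\<close>, \<open>I\<close> can start from either
  diagonal block. One order leaves \<open>I + V U\<close> as the Schur complement, the other \<open>I + U V\<close>,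
  and the same two unitriangular factors occur in both factorizations.\<close>

theorem Sylvester_determinant:
  fixes U :: "real ^ 'b ^ 'a" and V :: "real ^ 'a ^ 'b"
  shows "det (mat 1 + U ** V) = det (mat 1 + V ** U)"
proof -
  let ?Up = "\<lambda>U. four_blocks (mat 1) U 0 (mat 1) :: real ^ ('a + 'b) ^ ('a + 'b)"
  let ?Lo = "\<lambda>V. four_blocks (mat 1) 0 V (mat 1) :: real ^ ('a + 'b) ^ ('a + 'b)"
  have one: "four_blocks (mat 1) 0 0 (mat 1) = (mat 1 :: real ^ ('a + 'b) ^ ('a + 'b))"
    by (auto simp: four_blocks_def vec_eq_iff mat_def split: sum.split)
  have "det (?Up (- U)) * det (?Up U) = 1" "det (?Lo V) * det (?Lo (- V)) = 1"
    by (simp_all add: det_mul[symmetric] four_blocks_mult one)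
  \<comment> \<open>These determinants are 1, but nonvanishing suffices to cancel them and follows from invertibility.\<close>
  then have nz: "det (?Up (- U)) \<noteq> 0" "det (?Lo V) \<noteq> 0" by auto
  have neg: "(- U) ** V = - (U ** V)" "V ** (- U) = - (V ** U)"
    by (simp_all add: matrix_matrix_mult_def vec_eq_iff sum_negf)
  have "?Lo V ** (four_blocks (mat 1) 0 0 (mat 1 + V ** U) ** ?Up (- U))
      = ?Up (- U) ** (four_blocks (mat 1 + U ** V) 0 0 (mat 1) ** ?Lo V)"
    by (simp add: four_blocks_mult matrix_add_ldistrib matrix_add_rdistrib neg)
  from arg_cong[OF this, of det] nz show ?thesis
    by (simp add: det_mul det_four_blocks_upper_left det_four_blocks_lower_right)
qed

text \<open>For invertible \<open>N\<close> this is the rule \<open>det N * det (I + U N\<^sup>-\<^sup>1 W) = det (N + W U)\<close>, with \<open>V\<close> in the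
  place of \<open>N\<^sup>-\<^sup>1 W\<close>. In this form \<open>V\<close> may be any solution of the linear system, which is
  how the stage Jacobians are given.\<close>

corollary matrix_determinant_lemma:
  fixes N :: "real ^ 'b ^ 'b" and U :: "real ^ 'b ^ 'a" and V W :: "real ^ 'a ^ 'b"
  assumes "N ** V = W"
  shows "det N * det (mat 1 + U ** V) = det (N + W ** U)"
proof -
  have "N + W ** U = N ** (mat 1 + V ** U)"
    by (simp add: matrix_add_ldistrib matrix_mul_assoc assms)
  then show ?thesis by (simp add: det_mul Sylvester_determinant[of U V])
qed

section \<open>Block matrices\<close>

definition block_column :: "('s::finite \<Rightarrow> real ^ 'n ^ 'n) \<Rightarrow> real ^ 'n ^ ('s \<times> 'n)" where
  "block_column C = (\<chi> p. C (fst p) $ snd p)"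

definition block_row :: "('s::finite \<Rightarrow> real ^ 'n ^ 'n) \<Rightarrow> real ^ ('s \<times> 'n) ^ 'n" where
  "block_row R = (\<chi> i q. R (fst q) $ i $ snd q)"

lemma sum_product_index:
  "(\<Sum>r\<in>(UNIV :: ('s::finite \<times> 'n::finite) set). u r) = (\<Sum>l\<in>UNIV. \<Sum>m\<in>UNIV. u (l, m))"
  by (simp add: sum.cartesian_product UNIV_Times_UNIV)

lemma block_matrix_mult:
  "block_matrix B ** block_matrix C = block_matrix (\<lambda>i j. \<Sum>l\<in>UNIV. B i l ** C l j)"
  by (simp add: block_matrix_def matrix_matrix_mult_def vec_eq_iff sum_product_index)

lemma block_matrix_mult_column:
  "block_matrix B ** block_column C = block_column (\<lambda>i. \<Sum>l\<in>UNIV. B i l ** C l)"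
  by (simp add: block_matrix_def block_column_def matrix_matrix_mult_def vec_eq_iff sum_product_index)

lemma block_row_mult_column:
  "block_row R ** block_column C = (\<Sum>l\<in>UNIV. R l ** C l)"
  by (simp add: block_row_def block_column_def matrix_matrix_mult_def vec_eq_iff sum_product_index)

lemma block_column_mult_row:
  "block_column C ** block_row R = block_matrix (\<lambda>i j. C i ** R j)"
  by (simp add: block_matrix_def block_row_def block_column_def matrix_matrix_mult_def vec_eq_iff)

lemma block_matrix_add: "block_matrix B + block_matrix C = block_matrix (\<lambda>i j. B i j + C i j)"
  by (simp add: block_matrix_def vec_eq_iff)

lemma block_matrix_scaleR: "r *\<^sub>R block_matrix B = block_matrix (\<lambda>i j. r *\<^sub>R B i j)"
  by (simp add: block_matrix_def vec_eq_iff)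

lemma mat_1_eq_block_matrix:
  "(mat 1 :: real ^ ('s::finite \<times> 'n::finite) ^ ('s \<times> 'n)) = block_matrix (\<lambda>i j. if i = j then mat 1 else 0)"
  by (auto simp: block_matrix_def vec_eq_iff mat_def prod_eq_iff)

lemma kron_mat_1: "kron (mat 1) (mat 1) = mat 1"
  by (auto simp: kron_def block_matrix_def vec_eq_iff mat_def prod_eq_iff)

lemma block_scale_mult_stage_jacobians:
  "block_scale M E ** stage_jacobians g k y
    = block_matrix (\<lambda>i j. M $ i $ j *\<^sub>R (E i j ** jacobian g (at (k j y))))"
proof -
  have "(\<Sum>l\<in>UNIV. (M $ i $ l *\<^sub>R E i l) ** (if l = j then jacobian g (at (k l y)) else 0))
      = M $ i $ j *\<^sub>R (E i j ** jacobian g (at (k j y)))" for i j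
    by (simp add: if_distrib[of "\<lambda>X. _ ** X"] scalar_matrix_assoc cong: if_cong)
  then show ?thesis
    by (simp add: block_scale_def stage_jacobians_def block_diag_def block_matrix_mult)
qed

text \<open>The hypothesis says \<open>W B = C W\<close> for the block diagonal matrix \<open>W\<close> with blocks \<open>w\<^sub>i I\<close>,
  so the two matrices are similar.\<close>

lemma det_weighted_conjugation:
  fixes B C :: "'s::finite \<Rightarrow> 's \<Rightarrow> real ^ 'n ^ 'n"
  assumes "\<And>i. w i \<noteq> 0"
    and conj: "\<And>i j. w i *\<^sub>R B i j = w j *\<^sub>R C i j"
  shows "det (block_matrix B) = det (block_matrix C)"
proof -
  let ?W = "block_matrix (\<lambda>i j. if i = j then w i *\<^sub>R mat 1 else 0) :: real ^ ('s \<times> 'n) ^ ('s \<times> 'n)"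
  have "?W ** block_matrix B = block_matrix C ** ?W"
  proof -
    have "(\<Sum>l\<in>UNIV. (if i = l then w i *\<^sub>R mat 1 else 0) ** B l j) = w i *\<^sub>R B i j" for i j
      by (simp add: if_distrib[of "\<lambda>X. X ** _"] scalar_matrix_assoc[symmetric] cong: if_cong)
    moreover have "(\<Sum>l\<in>UNIV. C i l ** (if l = j then w l *\<^sub>R mat 1 else 0)) = w j *\<^sub>R C i j" for i j
      by (simp add: if_distrib[of "\<lambda>X. _ ** X"] matrix_scalar_ac scalar_matrix_assoc[symmetric] cong: if_cong)
    ultimately show ?thesis by (simp add: block_matrix_mult conj)
  qed
  then have "det ?W * det (block_matrix B) = det (block_matrix C) * det ?W"
    by (metis (no_types) det_mul)
  moreover have "det ?W \<noteq> 0"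
  proof -
    have "det ?W = (\<Prod>p\<in>UNIV. ?W $ p $ p)"
      by (rule det_diagonal) (auto simp: block_matrix_def mat_def prod_eq_iff)
    with assms(1) show ?thesis by (simp add: block_matrix_def mat_def)
  qed
  ultimately show ?thesis by simp
qed

section \<open>Derivatives of the stages and of the update\<close>

lemma jacobian_eqI:
  fixes f :: "real ^ 'm \<Rightarrow> real ^ 'n"
  assumes "(f has_derivative (\<lambda>v. M *v v)) (at y)"
  shows "jacobian f (at y) = M"
  by (simp add: jacobian_def frechet_derivative_at[OF assms, symmetric]
      matrix_of_matrix_vector_mul)

text \<open>Each stage equation and the update have this shape, with \<open>P\<close> and the \<open>Q j\<close> exponentials of
  multiples of \<open>K\<close> and \<open>r\<close> a row of \<open>A\<close> or the vector \<open>b\<close>.\<close>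

lemma has_derivative_exponential_sum:
  fixes g :: "real ^ 'n \<Rightarrow> real ^ 'n" and k :: "'s::finite \<Rightarrow> real ^ 'n \<Rightarrow> real ^ 'n"
    and P :: "real ^ 'n ^ 'n" and Q :: "'s \<Rightarrow> real ^ 'n ^ 'n"
  assumes g_diff: "\<And>y. g differentiable at y" and k_diff: "\<And>i y. k i differentiable at y"
  shows "((\<lambda>y. P *v y + h *\<^sub>R (\<Sum>j\<in>UNIV. r j *\<^sub>R (Q j *v g (k j y)))) has_derivative
    (\<lambda>v. (P + h *\<^sub>R (\<Sum>j\<in>UNIV. r j *\<^sub>R (Q j ** jacobian g (at (k j y)) ** jacobian (k j) (at y)))) *v v))
    (at y)"
proof -
  have "((\<lambda>y. g (k j y)) has_derivative
      (\<lambda>v. jacobian g (at (k j y)) *v (jacobian (k j) (at y) *v v))) (at y)" for j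
    using has_derivative_compose[OF k_diff[unfolded jacobian_works] g_diff[unfolded jacobian_works]] .
  then have "((\<lambda>y. r j *\<^sub>R (Q j *v g (k j y))) has_derivative
      (\<lambda>v. r j *\<^sub>R (Q j *v (jacobian g (at (k j y)) *v (jacobian (k j) (at y) *v v))))) (at y)" for j
    by (intro has_derivative_scaleR_right
        bounded_linear.has_derivative[OF matrix_vector_mul_bounded_linear])
  then have "((\<lambda>y. h *\<^sub>R (\<Sum>j\<in>UNIV. r j *\<^sub>R (Q j *v g (k j y)))) has_derivative
      (\<lambda>v. h *\<^sub>R (\<Sum>j\<in>UNIV. r j *\<^sub>R
          (Q j *v (jacobian g (at (k j y)) *v (jacobian (k j) (at y) *v v)))))) (at y)"
    by (rule has_derivative_scaleR_right[OF has_derivative_sum])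
  from has_derivative_add[OF bounded_linear_imp_has_derivative[OF matrix_vector_mul_bounded_linear] this]
  have "((\<lambda>y. P *v y + h *\<^sub>R (\<Sum>j\<in>UNIV. r j *\<^sub>R (Q j *v g (k j y)))) has_derivative
    (\<lambda>v. P *v v + h *\<^sub>R (\<Sum>j\<in>UNIV. r j *\<^sub>R
        (Q j *v (jacobian g (at (k j y)) *v (jacobian (k j) (at y) *v v)))))) (at y)" .
  moreover have "(\<Sum>j\<in>UNIV. r j *\<^sub>R (Q j ** jacobian g (at (k j y)) ** jacobian (k j) (at y))) *v v
     = (\<Sum>j\<in>UNIV. r j *\<^sub>R (Q j *v (jacobian g (at (k j y)) *v (jacobian (k j) (at y) *v v))))" for v
  proof -
    have "(\<Sum>j\<in>S. M j) *v v = (\<Sum>j\<in>S. M j *v v)" for S :: "'s set" and M :: "'s \<Rightarrow> real ^ 'n ^ 'n"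
      by (induction S rule: infinite_finite_induct)
        (simp_all add: matrix_vector_mult_add_rdistrib)
    then show ?thesis
      by (simp add: scaleR_matrix_vector_assoc[symmetric] matrix_vector_mul_assoc matrix_mul_assoc)
  qed
  ultimately show ?thesis
    by (simp add: matrix_vector_mult_add_rdistrib scaleR_matrix_vector_assoc[symmetric])
qed

section \<open>The Jacobian determinant of a symplectic exponential integrator\<close>

text \<open>The pointwise identity from which the criterion follows by cancelling \<open>det N\<close>. The
  stages are implicit, so their Jacobians are not computed but only used through the linear
  system \<open>N J = Q\<close> that they satisfy.\<close>

lemma det_jacobian_ssei_map:
  fixes K :: "real ^ 'n ^ 'n" and A :: "real ^ 's ^ 's" and b c :: "real ^ 's"
  assumes g_diff: "\<And>y. g differentiable at y"
    and symplectic: "symplectic_RK A b"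
    and b_nonzero: "\<And>j. b $ j \<noteq> 0"
    and stages: "ssei_stages A c K g h k"
    and k_diff: "\<And>i y. k i differentiable at y"
  shows "ssei_map b c K g h k differentiable at y" (is ?diff)
    and "det (mat 1 - h *\<^sub>R (block_scale A (E_block c (h *\<^sub>R K)) ** stage_jacobians g k y))
          * det (jacobian (ssei_map b c K g h k) (at y))
       = det (mexp (h *\<^sub>R K))
          * det (mat 1 + h *\<^sub>R (block_scale (transpose A) (E_block c (h *\<^sub>R K)) ** stage_jacobians g k y))"
      (is "det ?N * _ = _ * det ?N'")
proof -
  define X where "X = h *\<^sub>R K"
  define G where "G j = jacobian g (at (k j y))" for j
  define J where "J j = jacobian (k j) (at y)" for j
  define Q where "Q i = mexp (c $ i *\<^sub>R X)" for i
  define R where "R j = b $ j *\<^sub>R (mexp ((- c $ j) *\<^sub>R X) ** G j)" for j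
  define H where "H i j = E_block c X i j ** G j" for i j
  note deriv = has_derivative_exponential_sum[where g = g and k = k and y = y,
      OF g_diff k_diff, folded G_def J_def]
  have N: "?N = mat 1 - h *\<^sub>R block_matrix (\<lambda>i j. A $ i $ j *\<^sub>R H i j)"
    and N': "?N' = mat 1 + h *\<^sub>R block_matrix (\<lambda>i j. A $ j $ i *\<^sub>R H i j)"
    by (simp_all add: block_scale_mult_stage_jacobians H_def G_def X_def Finite_Cartesian_Product.transpose_def)

  have stage_eq: "J i = Q i + h *\<^sub>R (\<Sum>j\<in>UNIV. A $ i $ j *\<^sub>R (H i j ** J j))" for i
  proof -
    have "k i = (\<lambda>y. mexp ((c $ i * h) *\<^sub>R K) *v y
        + h *\<^sub>R (\<Sum>j\<in>UNIV. A $ i $ j *\<^sub>R (mexp (((c $ i - c $ j) * h) *\<^sub>R K) *v g (k j y))))"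
      using stages unfolding ssei_stages_def by blast
    also have "\<dots> = (\<lambda>y. Q i *v y + h *\<^sub>R (\<Sum>j\<in>UNIV. A $ i $ j *\<^sub>R (E_block c X i j *v g (k j y))))"
      by (simp add: Q_def E_block_def X_def)
    finally show ?thesis
      using jacobian_eqI[OF deriv[of "Q i" h "\<lambda>j. A $ i $ j" "E_block c X i"]]
      by (simp only: J_def H_def)
  qed
  have NJ: "?N ** block_column J = block_column Q"
  proof -
    have "?N ** block_column J = block_column J
        - h *\<^sub>R (block_matrix (\<lambda>i j. A $ i $ j *\<^sub>R H i j) ** block_column J)"
      unfolding N by (simp only: matrix_diff_rdistrib matrix_mul_lid scalar_matrix_assoc)
    also have "\<dots> = block_column (\<lambda>i. J i - h *\<^sub>R (\<Sum>j\<in>UNIV. A $ i $ j *\<^sub>R (H i j ** J j)))"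
      by (simp add: block_matrix_mult_column scalar_matrix_assoc)
        (simp add: block_column_def vec_eq_iff)
    also have "\<dots> = block_column Q"
    proof -
      have "J i - h *\<^sub>R (\<Sum>j\<in>UNIV. A $ i $ j *\<^sub>R (H i j ** J j)) = Q i" for i
        unfolding diff_eq_eq by (rule stage_eq)
      then show ?thesis by simp
    qed
    finally show ?thesis .
  qed

  have map_eq: "ssei_map b c K g h k
      = (\<lambda>y. mexp X *v y + h *\<^sub>R (\<Sum>j\<in>UNIV. b $ j *\<^sub>R (mexp ((1 - c $ j) *\<^sub>R X) *v g (k j y))))"
    by (simp add: ssei_map_def fun_eq_iff X_def)
  note map_deriv = deriv[of "mexp X" h "\<lambda>j. b $ j" "\<lambda>j. mexp ((1 - c $ j) *\<^sub>R X)", folded map_eq]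
  show ?diff using map_deriv by (rule differentiableI)
  have exp_split: "mexp ((1 - c $ j) *\<^sub>R X) = mexp X ** mexp ((- c $ j) *\<^sub>R X)" for j
    using mexp_add[of 1 "- c $ j" X] by simp
  have "b $ j *\<^sub>R (mexp ((1 - c $ j) *\<^sub>R X) ** G j ** J j) = mexp X ** (R j ** J j)" for j
    unfolding exp_split by (simp add: R_def matrix_mul_assoc matrix_scalar_ac scalar_matrix_assoc)
  then have "jacobian (ssei_map b c K g h k) (at y)
      = mexp X ** (mat 1 + h *\<^sub>R (\<Sum>j\<in>UNIV. R j ** J j))"
    using jacobian_eqI[OF map_deriv]
    by (simp add: matrix_add_ldistrib matrix_scalar_ac scalar_matrix_assoc[symmetric] matrix_sum_ldistrib
        scaleR_sum_right)
  also have "\<dots> = mexp X ** (mat 1 + (h *\<^sub>R block_row R) ** block_column J)"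
    by (simp add: scalar_matrix_assoc[symmetric] block_row_mult_column)
  finally have "det ?N * det (jacobian (ssei_map b c K g h k) (at y))
      = det (mexp X) * (det ?N * det (mat 1 + (h *\<^sub>R block_row R) ** block_column J))"
    by (simp add: det_mul)
  also have "det ?N * det (mat 1 + (h *\<^sub>R block_row R) ** block_column J)
      = det (?N + block_column Q ** (h *\<^sub>R block_row R))"
    using NJ by (rule matrix_determinant_lemma)
  also have "?N + block_column Q ** (h *\<^sub>R block_row R)
      = mat 1 + h *\<^sub>R block_matrix (\<lambda>i j. (b $ j - A $ i $ j) *\<^sub>R H i j)"
  proof -
    have "Q i ** R j = b $ j *\<^sub>R H i j" for i j
      using mexp_add[of "c $ i" "- c $ j" X]
      by (simp add: Q_def R_def H_def E_block_def matrix_mul_assoc matrix_scalar_ac scalar_matrix_assoc)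
    then have "block_column Q ** (h *\<^sub>R block_row R) = h *\<^sub>R block_matrix (\<lambda>i j. b $ j *\<^sub>R H i j)"
      by (simp add: matrix_scalar_ac scalar_matrix_assoc[symmetric] block_column_mult_row)
    then show ?thesis
      by (simp add: N block_matrix_def vec_eq_iff algebra_simps)
  qed
  also have "det \<dots> = det ?N'"
    unfolding N' unfolding mat_1_eq_block_matrix block_matrix_scaleR block_matrix_add
  proof (rule det_weighted_conjugation[of "\<lambda>i. b $ i"])
    fix i j
    \<comment> \<open>Symplecticity, in the form required for conjugation by the weights \<open>b\<close>.\<close>
    have "b $ i * (b $ j - A $ i $ j) = b $ j * A $ j $ i"
      using symplectic by (simp add: symplectic_RK_def algebra_simps)
    then have "b $ i *\<^sub>R h *\<^sub>R (b $ j - A $ i $ j) *\<^sub>R H i j = b $ j *\<^sub>R h *\<^sub>R A $ j $ i *\<^sub>R H i j"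
      by (simp add: mult.left_commute)
    then show "b $ i *\<^sub>R ((if i = j then mat 1 else 0) + h *\<^sub>R (b $ j - A $ i $ j) *\<^sub>R H i j)
        = b $ j *\<^sub>R ((if i = j then mat 1 else 0) + h *\<^sub>R A $ j $ i *\<^sub>R H i j)"
      by (simp only: scaleR_add_right) simp
  qed (rule b_nonzero)
  finally show "det ?N * det (jacobian (ssei_map b c K g h k) (at y)) = det (mexp (h *\<^sub>R K)) * det ?N'"
    by (simp only: X_def)
qed

theorem lemma3p2:
  fixes K :: "real ^ 'n ^ 'n"
    and g :: "real ^ 'n \<Rightarrow> real ^ 'n"
    and A :: "real ^ 's ^ 's"
    and b c :: "real ^ 's"
    and h :: real
    and k :: "'s \<Rightarrow> real ^ 'n \<Rightarrow> real ^ 'n"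
  assumes det_exp: "\<And>t. 0 < t \<Longrightarrow> t < 1 \<Longrightarrow> det (mexp (t *\<^sub>R K)) \<noteq> - 1"
    and g_diff: "\<And>y. g differentiable at y"
    and div_free: "divergence_free (\<lambda>y. K *v y + g y)"
    and symplectic: "symplectic_RK A b"
    and b_nonzero: "\<And>j. b $ j \<noteq> 0"
    and stages: "ssei_stages A c K g h k"
    and k_diff: "\<And>i y. k i differentiable at y"
    and inv: "\<And>y. invertible (kron (mat 1) (mat 1)
                - h *\<^sub>R (block_scale A (E_block c (h *\<^sub>R K)) ** stage_jacobians g k y))"
  shows "volume_preserving (ssei_map b c K g h k) \<longleftrightarrow>
    (\<forall>y. det (kron (mat 1) (mat 1)
              - h *\<^sub>R (block_scale A (E_block c (h *\<^sub>R K)) ** stage_jacobians g k y))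
       = det (mexp (h *\<^sub>R K))
         * det (kron (mat 1) (mat 1)
              + h *\<^sub>R (block_scale (transpose A) (E_block c (h *\<^sub>R K)) ** stage_jacobians g k y)))"
proof -
  have "ssei_map b c K g h k differentiable at y \<and>
      (det (jacobian (ssei_map b c K g h k) (at y)) = 1 \<longleftrightarrow>
        det (kron (mat 1) (mat 1)
              - h *\<^sub>R (block_scale A (E_block c (h *\<^sub>R K)) ** stage_jacobians g k y))
        = det (mexp (h *\<^sub>R K))
          * det (kron (mat 1) (mat 1)
              + h *\<^sub>R (block_scale (transpose A) (E_block c (h *\<^sub>R K)) ** stage_jacobians g k y)))"
    (is "_ \<and> (?d = 1 \<longleftrightarrow> ?N = ?e * ?N')") for y
  proof -
    note jac = det_jacobian_ssei_map[OF g_diff symplectic b_nonzero stages k_diff, where y = y]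
    have "?N \<noteq> 0" using inv by (simp add: invertible_det_nz)
    moreover have "?N * ?d = ?e * ?N'" using jac(2) by (simp only: kron_mat_1)
    ultimately show ?thesis using jac(1) by auto
  qed
  then show ?thesis by (simp add: volume_preserving_def)
qed

end
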